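(* Let $K$ be an arbitrary field. Let \[ a(t)=\sum_{n\geq 0}a_nt^n \] be a power series with nonnegative integer coefficients, and let $d$ be a positive integer such that $a_n\leq d^n$ for all $n=0,1,2,\ldots$. Then for any integer $p\in\{0,1,2\}$ there exists a $(d+1)$-generated monomial algebra $R$ over $K$ such that its Hilbert series is \[ H(R,t)=\frac{1}{1-dt}+\frac{t}{(1-dt)^2}+\frac{t^2a(t)}{(1-dt)^p}. \]
   Context: Algebras are unitary associative algebras over a field $K$ of any characteristic. For a positive integer $m$, let $K\langle X_m\rangle=K\langle x_1,\ldots,x_m\rangle$ be the free $m$-generated unitary associative algebra and let $\langle X_m\rangle$ be the set of all monomials (words, including the empty word $1$) in $x_1,\ldots,x_m$. An $m$-generated monomial algebra is a factor algebra $R=K\langle X_m\rangle/(U)$, where $U\subseteq\langle X_m\rangle$ is a (possibly infinite) set of monomials and $(U)$ is the two-sided ideal generated by $U$. It is graded by degree, $R=R_0\oplus R_1\oplus R_2\oplus\cdots$, with all generators $x_i$ of degree $1$, where $R_n$ is the image of the span of the monomials of degree $n$. The Hilbert series of $R$ is the formal power series $H(R,t)=\sum_{n\geq 0}\dim_K(R_n)\,t^n$. Rational expressions in $t$ are expanded as formal power series in $t$. *)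

theory Defs
  imports
    "HOL-Library.Poly_Mapping"
    "HOL-Algebra.QuotRing"
    "HOL-Computational_Algebra.Formal_Power_Series"
    "Jordan_Normal_Form.VS_Connect"
begin

text \<open>Words form the free monoid, written additively (\<open>0\<close> is the empty word and \<open>+\<close> is
  concatenation), so that multiplication of finitely supported functions
  \<open>'x list \<Rightarrow>\<^sub>0 'k\<close> is the multiplication of noncommutative polynomials.\<close>

instantiation list :: (type) monoid_add
begin
definition zero_list_def: "0 = []"
definition plus_list_def: "xs + ys = xs @ ys"
instance by standard (simp_all add: zero_list_def plus_list_def)
end

definition words :: "nat \<Rightarrow> nat list set" where
  "words m = lists {1..m}"

definition free_alg :: "nat \<Rightarrow> ('k::field, nat list \<Rightarrow>\<^sub>0 'k) module" where
  "free_alg m =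
    \<lparr>carrier = {f. Poly_Mapping.keys f \<subseteq> words m},
     monoid.mult = (*), one = 1, zero = 0, add = (+),
     smult = (\<lambda>c. Poly_Mapping.map ((*) c))\<rparr>"

definition monomial :: "nat list \<Rightarrow> nat list \<Rightarrow>\<^sub>0 'k::field" where
  "monomial w = Poly_Mapping.single w 1"

text \<open>In \<open>HOL-Algebra\<close> ideals are two-sided, so \<open>Idl\<close> generates a two-sided ideal.\<close>

definition monomial_ideal :: "nat \<Rightarrow> nat list set \<Rightarrow> (nat list \<Rightarrow>\<^sub>0 'k::field) set" where
  "monomial_ideal m U = Idl\<^bsub>free_alg m\<^esub> (monomial ` U)"

text \<open>\<open>c \<odot> (I + f) = I + c \<odot> f\<close>: in the scalar multiplication below, the union ranges over equal
  cosets, as in \<open>rcoset_mult\<close>.\<close>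

definition monomial_alg :: "nat \<Rightarrow> nat list set \<Rightarrow> ('k::field, (nat list \<Rightarrow>\<^sub>0 'k) set) module" where
  "monomial_alg m U =
    (let F = free_alg m; I = monomial_ideal m U; Q = F Quot I in
      \<lparr>carrier = carrier Q, monoid.mult = monoid.mult Q, one = one Q, zero = zero Q, add = add Q,
       smult = (\<lambda>c A. \<Union>f\<in>A. I +>\<^bsub>F\<^esub> (c \<odot>\<^bsub>F\<^esub> f))\<rparr>)"

definition graded_component :: "nat \<Rightarrow> nat list set \<Rightarrow> nat \<Rightarrow> (nat list \<Rightarrow>\<^sub>0 'k::field) set set" where
  "graded_component m U n =
    (\<lambda>f. monomial_ideal m U +>\<^bsub>free_alg m\<^esub> f) `
      LinearCombinations.module.span class_ring (free_alg m)
        (monomial ` {w \<in> words m. length w = n})"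

text \<open>The type of the series does not mention \<open>'k\<close>, hence the \<open>itself\<close> argument. The coefficients are
  taken in \<open>rat\<close> because division of formal power series is defined via \<open>inverse\<close> on coefficients.\<close>

definition hilbert_series :: "'k::field itself \<Rightarrow> nat \<Rightarrow> nat list set \<Rightarrow> rat fps" where
  "hilbert_series K m U = Abs_fps (\<lambda>n. of_nat
    (vectorspace.dim (class_ring :: 'k ring)
      (monomial_alg m U \<lparr>carrier := graded_component m U n\<rparr>)))"

end

theory Submission
  imports Defs "HOL-Library.Sublist"
begin

unbundle fps_syntax

text \<open>The Hilbert series of a monomial algebra counts words. The ideal generated by a set \<open>U\<close> of
  monomials consists of the polynomials supported on the words with a factor in \<open>U\<close>
  (\<open>monomial_ideal_eq\<close>), so the images of the remaining words of length \<open>n\<close> form a basis of the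
  component of degree \<open>n\<close> (\<open>dim_graded_component\<close>). Conversely every language \<open>G\<close> that is closed
  under taking factors is the set of surviving words of some monomial algebra: take the complement
  of \<open>G\<close> as \<open>U\<close> (\<open>normal_words_complement\<close>). It remains to find a factor-closed language over
  \<open>d + 1\<close> letters with the prescribed counting series.

  Let \<open>X\<close> be the set of words in the first \<open>d\<close> letters and let the last letter \<open>y\<close> serve as a
  marker. Since \<open>a n \<le> d ^ n\<close>, there is a language \<open>W \<subseteq> X\<close> with exactly \<open>a n\<close> words of each
  length \<open>n\<close>. Let \<open>G\<close> consist of all words without \<open>y\<close>, all words with one \<open>y\<close>, and those words
  \<open>u y w y v\<close> with \<open>w \<in> W\<close> for which \<open>u \<in> P\<close> and \<open>v \<in> Q\<close>; here \<open>P\<close> and \<open>Q\<close> are either \<open>X\<close> or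
  contain only the empty word, and \<open>p\<close> is the number of those that are \<open>X\<close>. A factor of a
  word with two markers either keeps both of them, and with them the middle word \<open>w\<close>, or has at
  most one marker and is then unrestricted. So \<open>G\<close> is factor-closed however \<open>W\<close> was chosen
  (\<open>marked_language_factor_closed\<close>). The series of \<open>X\<close> is \<open>1 / (1 - d t)\<close>, each marker contributes
  a factor \<open>t\<close>, and a word determines its decomposition at the markers, so the three kinds of words
  contribute the three summands of the formula (\<open>census_marked_language\<close>).\<close>

section \<open>Monomial ideals and normal words\<close>

definition multiples :: "nat \<Rightarrow> nat list set \<Rightarrow> nat list set" where
  "multiples m U = {w \<in> words m. \<exists>u\<in>U. sublist u w}"

definition normal_words :: "nat \<Rightarrow> nat list set \<Rightarrow> nat list set" where
  "normal_words m U = {w \<in> words m. \<forall>u\<in>U. \<not> sublist u w}"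

lemma append_in_words [simp]: "v @ w \<in> words m \<longleftrightarrow> v \<in> words m \<and> w \<in> words m"
  by (auto simp: words_def)

lemma Cons_in_words [simp]: "x # w \<in> words m \<longleftrightarrow> x \<in> {1..m} \<and> w \<in> words m"
  by (auto simp: words_def)

lemma finite_words_of_length: "finite {w \<in> words m. length w = n}"
proof -
  have "{w \<in> words m. length w = n} = {w. set w \<subseteq> {1..m} \<and> length w = n}"
    by (auto simp: words_def lists_eq_set)
  then show ?thesis by (simp add: finite_lists_length_eq)
qed

lemma card_words_of_length: "card {w \<in> words m. length w = n} = m ^ n"
proof -
  have "{w \<in> words m. length w = n} = {w. set w \<subseteq> {1..m} \<and> length w = n}"
    by (auto simp: words_def lists_eq_set)
  then show ?thesis by (simp add: card_lists_length_eq)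
qed

lemma lookup_sum_single:
  assumes "finite W"
  shows "Poly_Mapping.lookup (\<Sum>w\<in>W. Poly_Mapping.single w (b w)) k = (if k \<in> W then b k else 0)"
  using assms by (simp add: lookup_sum lookup_single when_def)

lemma keys_monomial [simp]: "Poly_Mapping.keys (monomial w :: _ \<Rightarrow>\<^sub>0 'k::field) = {w}"
  by (simp add: monomial_def)

lemma monomial_inject [simp]: "(monomial v :: _ \<Rightarrow>\<^sub>0 'k::field) = monomial w \<longleftrightarrow> v = w"
  using keys_monomial[of v, where ?'k='k] keys_monomial[of w, where ?'k='k] by (metis singleton_inject)

lemma sum_single_keys:
  "(\<Sum>w\<in>Poly_Mapping.keys f. Poly_Mapping.single w (Poly_Mapping.lookup f w)) = f"
  by (rule poly_mapping_eqI) (simp add: lookup_sum_single in_keys_iff)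

lemma lookup_map_times:
  "Poly_Mapping.lookup (Poly_Mapping.map ((*) c) f) k = (c::'k::field) * Poly_Mapping.lookup f k"
  by (simp add: Poly_Mapping.map.rep_eq when_def)

lemma map_times_simps:
  fixes a b :: "'k::field"
  shows "Poly_Mapping.map ((*) (a + b)) f = Poly_Mapping.map ((*) a) f + Poly_Mapping.map ((*) b) f"
    and "Poly_Mapping.map ((*) a) (f + g) = Poly_Mapping.map ((*) a) f + Poly_Mapping.map ((*) a) g"
    and "Poly_Mapping.map ((*) (a * b)) f = Poly_Mapping.map ((*) a) (Poly_Mapping.map ((*) b) f)"
    and "Poly_Mapping.map ((*) (1::'k)) f = f"
  by (rule poly_mapping_eqI, simp add: lookup_map_times lookup_add distrib_left distrib_right)+

lemma free_alg_simps [simp]: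
  "carrier (free_alg m) = {f. Poly_Mapping.keys f \<subseteq> words m}"
  "monoid.mult (free_alg m) = (*)" "one (free_alg m) = 1" "zero (free_alg m) = 0"
  "add (free_alg m) = (+)" "module.smult (free_alg m) c = Poly_Mapping.map ((*) c)"
  by (simp_all add: free_alg_def)

lemma keys_map_times: "Poly_Mapping.keys (Poly_Mapping.map ((*) (c::'k::field)) f) \<subseteq> Poly_Mapping.keys f"
  by (auto simp: in_keys_iff lookup_map_times)

lemma keys_uminus: "Poly_Mapping.keys (- f) = Poly_Mapping.keys (f :: 'a \<Rightarrow>\<^sub>0 'b::ab_group_add)"
  by (auto simp: in_keys_iff)

lemma keys_mult_words:
  assumes "Poly_Mapping.keys f \<subseteq> A" "Poly_Mapping.keys g \<subseteq> B"
    "\<And>v w. v \<in> A \<Longrightarrow> w \<in> B \<Longrightarrow> v @ w \<in> C"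
  shows "Poly_Mapping.keys (f * g) \<subseteq> C"
  using keys_mult[of f g] assms by (fastforce simp: plus_list_def)

lemma keys_plus_subset:
  assumes "Poly_Mapping.keys f \<subseteq> A" "Poly_Mapping.keys g \<subseteq> A"
  shows "Poly_Mapping.keys (f + g) \<subseteq> A"
  using keys_add[of f g] assms by blast

lemma ring_free_alg: "ring (free_alg m :: ('k::field, _) module)"
proof (rule ringI)
  show "abelian_group (free_alg m :: ('k, _) module)"
  proof (rule abelian_groupI)
    show "\<exists>g\<in>carrier (free_alg m). g \<oplus>\<^bsub>free_alg m\<^esub> f = \<zero>\<^bsub>free_alg m\<^esub>"
      if "f \<in> carrier (free_alg m)" for f :: "nat list \<Rightarrow>\<^sub>0 'k"
      using that by (intro bexI[of _ "- f"]) (simp_all add: keys_uminus)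
  qed (simp_all add: keys_plus_subset add.assoc add.commute)
  show "Group.monoid (free_alg m :: ('k, _) module)"
  proof (rule Group.monoidI)
    show "f \<otimes>\<^bsub>free_alg m\<^esub> g \<in> carrier (free_alg m)"
      if "f \<in> carrier (free_alg m)" "g \<in> carrier (free_alg m)" for f g :: "nat list \<Rightarrow>\<^sub>0 'k"
      using that keys_mult_words[of f "words m" g "words m" "words m"] by simp
    show "\<one>\<^bsub>free_alg m\<^esub> \<in> carrier (free_alg m :: ('k, _) module)"
      by (simp add: zero_list_def words_def)
  qed (simp_all add: mult.assoc)
qed (simp_all add: distrib_left distrib_right)

lemma module_free_alg: "module class_ring (free_alg m :: ('k::field, _) module)"
proof -
  interpret ring "free_alg m :: ('k, _) module" by (rule ring_free_alg)
  show ?thesis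
  proof (rule moduleI)
    show "cring (class_ring :: 'k ring)" by (rule class_cring.is_cring)
    show "abelian_group (free_alg m :: ('k, _) module)" ..
  next
    show "c \<odot>\<^bsub>free_alg m\<^esub> f \<in> carrier (free_alg m)" if "f \<in> carrier (free_alg m)"
      for c and f :: "nat list \<Rightarrow>\<^sub>0 'k"
      using that keys_map_times[of c f] by auto
  qed (simp_all only: free_alg_simps ring.simps monoid.simps map_times_simps)
qed

lemma a_inv_free_alg:
  fixes f :: "nat list \<Rightarrow>\<^sub>0 'k::field"
  assumes "Poly_Mapping.keys f \<subseteq> words m"
  shows "\<ominus>\<^bsub>free_alg m\<^esub> f = - f"
proof -
  interpret ring "free_alg m :: ('k, _) module" by (rule ring_free_alg)
  show ?thesis
    using assms by (intro minus_equality) (simp_all add: keys_uminus)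
qed

lemma finsum_free_alg:
  fixes f :: "'a \<Rightarrow> nat list \<Rightarrow>\<^sub>0 'k::field"
  assumes "f \<in> A \<rightarrow> carrier (free_alg m)"
  shows "finsum (free_alg m) f A = sum f A"
proof -
  interpret ring "free_alg m :: ('k, _) module" by (rule ring_free_alg)
  show ?thesis using assms
    by (induction A rule: infinite_finite_induct) (auto simp: Pi_iff)
qed

lemma ideal_multiples:
  assumes "U \<subseteq> words m"
  shows "ideal {f. Poly_Mapping.keys f \<subseteq> multiples m U} (free_alg m :: ('k::field, _) module)"
proof (rule idealI, rule ring_free_alg)
  let ?J = "{f :: nat list \<Rightarrow>\<^sub>0 'k. Poly_Mapping.keys f \<subseteq> multiples m U}"
  interpret ring "free_alg m :: ('k, _) module" by (rule ring_free_alg)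
  have sub: "multiples m U \<subseteq> words m" by (auto simp: multiples_def)
  show "subgroup ?J (add_monoid (free_alg m))"
  proof (rule add.subgroupI)
    show "\<ominus>\<^bsub>free_alg m\<^esub> f \<in> ?J" if "f \<in> ?J" for f
      using that sub by (subst a_inv_free_alg) (auto simp: keys_uminus)
  next
    show "?J \<noteq> {}" by (rule ex_in_conv[THEN iffD1], rule exI[of _ 0]) simp
  qed (use sub in \<open>simp_all add: keys_plus_subset Collect_mono_iff\<close>, blast)
next
  fix a x :: "nat list \<Rightarrow>\<^sub>0 'k"
  assume "a \<in> {f. Poly_Mapping.keys f \<subseteq> multiples m U}" "x \<in> carrier (free_alg m)"
  then have a: "Poly_Mapping.keys a \<subseteq> multiples m U" and x: "Poly_Mapping.keys x \<subseteq> words m"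
    by auto
  have "v @ w \<in> multiples m U" if "v \<in> words m" "w \<in> multiples m U" for v w
    using that by (auto simp: multiples_def sublist_append)
  then show "x \<otimes>\<^bsub>free_alg m\<^esub> a \<in> {f. Poly_Mapping.keys f \<subseteq> multiples m U}"
    using keys_mult_words[OF x a] by auto
  have "w @ v \<in> multiples m U" if "v \<in> words m" "w \<in> multiples m U" for v w
    using that by (auto simp: multiples_def sublist_append)
  then show "a \<otimes>\<^bsub>free_alg m\<^esub> x \<in> {f. Poly_Mapping.keys f \<subseteq> multiples m U}"
    using keys_mult_words[OF a x] by auto
qed

text \<open>The functions supported on the multiples form an ideal containing the generators; conversely
  \<open>c \<cdot> x u y\<close> is the product of \<open>c \<cdot> x\<close>, \<open>u\<close> and \<open>y\<close>, and every polynomial is the sum of its terms.\<close>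

lemma monomial_ideal_eq:
  assumes U: "U \<subseteq> words m"
  shows "(monomial_ideal m U :: (nat list \<Rightarrow>\<^sub>0 'k::field) set)
    = {f. Poly_Mapping.keys f \<subseteq> multiples m U}"
proof
  interpret ring "free_alg m :: ('k, _) module" by (rule ring_free_alg)
  let ?I = "monomial_ideal m U :: (nat list \<Rightarrow>\<^sub>0 'k) set"
  have gen: "monomial ` U \<subseteq> carrier (free_alg m :: ('k, _) module)"
    using U by (auto simp: monomial_def)
  show "?I \<subseteq> {f. Poly_Mapping.keys f \<subseteq> multiples m U}"
    unfolding monomial_ideal_def
    using U by (intro genideal_minimal ideal_multiples) (auto simp: monomial_def multiples_def)
  interpret I: ideal ?I "free_alg m :: ('k, _) module"
    unfolding monomial_ideal_def using gen by (rule genideal_ideal)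
  have single: "Poly_Mapping.single w c \<in> ?I" if w: "w \<in> multiples m U" for w and c :: 'k
  proof -
    obtain u x y where u: "u \<in> U" "w = x @ u @ y" and "w \<in> words m"
      using w by (auto simp: multiples_def sublist_def)
    then have xy: "x \<in> words m" "y \<in> words m" by auto
    have "monomial u \<in> ?I"
      unfolding monomial_ideal_def using genideal_self[OF gen] u by auto
    moreover have "Poly_Mapping.single x c \<in> carrier (free_alg m)"
      "(Poly_Mapping.single y 1 :: _ \<Rightarrow>\<^sub>0 'k) \<in> carrier (free_alg m)"
      using xy by (auto split: if_splits)
    ultimately have
      "Poly_Mapping.single x c \<otimes>\<^bsub>free_alg m\<^esub> (monomial u \<otimes>\<^bsub>free_alg m\<^esub> Poly_Mapping.single y 1) \<in> ?I"
      by (intro I.I_l_closed I.I_r_closed)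
    then show ?thesis
      by (simp add: monomial_def mult_single u plus_list_def)
  qed
  show "{f. Poly_Mapping.keys f \<subseteq> multiples m U} \<subseteq> ?I"
  proof safe
    fix f :: "nat list \<Rightarrow>\<^sub>0 'k"
    assume f: "Poly_Mapping.keys f \<subseteq> multiples m U"
    have "(\<Sum>w\<in>W. Poly_Mapping.single w (Poly_Mapping.lookup f w)) \<in> ?I"
      if "finite W" "W \<subseteq> multiples m U" for W
      using that
    proof (induction W rule: finite_induct)
      case empty
      then show ?case using I.zero_closed by simp
    next
      case (insert w W)
      then show ?case using I.a_closed[of "Poly_Mapping.single w (Poly_Mapping.lookup f w)"] single
        by simp
    qed
    from this[OF finite_keys f] show "f \<in> ?I" by (simp add: sum_single_keys)
  qed
qed

section \<open>The graded components of a monomial algebra\<close>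

abbreviation coset :: "nat \<Rightarrow> nat list set \<Rightarrow> (nat list \<Rightarrow>\<^sub>0 'k::field) \<Rightarrow> (nat list \<Rightarrow>\<^sub>0 'k) set" where
  "coset m U f \<equiv> monomial_ideal m U +>\<^bsub>free_alg m\<^esub> f"

lemma monomial_ideal_ideal:
  assumes "U \<subseteq> words m"
  shows "ideal (monomial_ideal m U) (free_alg m :: ('k::field, _) module)"
  unfolding monomial_ideal_eq[OF assms] by (rule ideal_multiples[OF assms])

lemma coset_eq_iff:
  fixes f g :: "nat list \<Rightarrow>\<^sub>0 'k::field"
  assumes U: "U \<subseteq> words m" and "Poly_Mapping.keys f \<subseteq> words m" "Poly_Mapping.keys g \<subseteq> words m"
  shows "coset m U f = coset m U g \<longleftrightarrow> Poly_Mapping.keys (f - g) \<subseteq> multiples m U"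
proof -
  interpret ring "free_alg m :: ('k, _) module" by (rule ring_free_alg)
  show ?thesis
    using quotient_eq_iff_same_a_r_cos[OF monomial_ideal_ideal[OF U], of f g] assms
    by (simp add: a_minus_def a_inv_free_alg monomial_ideal_eq)
qed

text \<open>Scalar multiplication on the quotient is a union over all representatives of the coset. It is
  computed by one of them because all of them yield the same coset.\<close>

lemma coset_smult:
  fixes f :: "nat list \<Rightarrow>\<^sub>0 'k::field"
  assumes U: "U \<subseteq> words m" and f: "Poly_Mapping.keys f \<subseteq> words m"
  shows "c \<odot>\<^bsub>monomial_alg m U\<^esub> coset m U f = coset m U (Poly_Mapping.map ((*) c) f)"
proof -
  interpret ideal "monomial_ideal m U" "free_alg m :: ('k, _) module"
    by (rule monomial_ideal_ideal[OF U])
  have eq: "coset m U (Poly_Mapping.map ((*) c) g) = coset m U (Poly_Mapping.map ((*) c) f)"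
    if g: "g \<in> coset m U f" for g
  proof -
    have gc: "g \<in> carrier (free_alg m)"
      using g f a_elemrcos_carrier[of f g] by simp
    then have gw: "Poly_Mapping.keys g \<subseteq> words m" by simp
    have "coset m U g = coset m U f"
      using g f a_repr_independence'[of g f] by simp
    then have "Poly_Mapping.keys (g - f) \<subseteq> multiples m U"
      using gc f U by (simp add: coset_eq_iff)
    moreover have "Poly_Mapping.keys (Poly_Mapping.map ((*) c) g - Poly_Mapping.map ((*) c) f)
        \<subseteq> Poly_Mapping.keys (g - f)"
      by (auto simp: in_keys_iff lookup_minus lookup_map_times)
    ultimately show ?thesis
      using gw f keys_map_times[of c f] keys_map_times[of c g] by (subst coset_eq_iff[OF U]) blast+
  qed
  have "f \<in> coset m U f" using f by (intro a_rcos_self) simp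
  have "c \<odot>\<^bsub>monomial_alg m U\<^esub> coset m U f
      = (\<Union>g\<in>coset m U f. coset m U (Poly_Mapping.map ((*) c) g))"
    by (simp add: monomial_alg_def Let_def)
  also have "\<dots> = (\<Union>g\<in>coset m U f. coset m U (Poly_Mapping.map ((*) c) f))"
    by (intro SUP_cong refl eq)
  also have "\<dots> = coset m U (Poly_Mapping.map ((*) c) f)"
    using \<open>f \<in> coset m U f\<close> by blast
  finally show ?thesis .
qed

lemma coset_add:
  fixes f g :: "nat list \<Rightarrow>\<^sub>0 'k::field"
  assumes U: "U \<subseteq> words m" and "Poly_Mapping.keys f \<subseteq> words m" "Poly_Mapping.keys g \<subseteq> words m"
  shows "coset m U f \<oplus>\<^bsub>monomial_alg m U\<^esub> coset m U g = coset m U (f + g)"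
proof -
  interpret ideal "monomial_ideal m U" "free_alg m :: ('k, _) module"
    by (rule monomial_ideal_ideal[OF U])
  show ?thesis using assms a_rcos_sum[of f g] by (simp add: monomial_alg_def Let_def FactRing_def)
qed

lemma coset_zero:
  assumes U: "U \<subseteq> words m"
  shows "\<zero>\<^bsub>monomial_alg m U\<^esub> = coset m U (0 :: nat list \<Rightarrow>\<^sub>0 'k::field)"
proof -
  interpret ideal "monomial_ideal m U" "free_alg m :: ('k, _) module"
    by (rule monomial_ideal_ideal[OF U])
  show ?thesis using a_coset_add_zero[OF a_subset] by (simp add: monomial_alg_def Let_def FactRing_def)
qed

lemma span_monomials:
  assumes "W \<subseteq> words m"
  shows "LinearCombinations.module.span class_ring (free_alg m) (monomial ` W)
    = {f :: nat list \<Rightarrow>\<^sub>0 'k::field. Poly_Mapping.keys f \<subseteq> W}" (is "?span = ?S")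
proof -
  interpret M: module class_ring "free_alg m :: ('k, _) module" by (rule module_free_alg)
  have lc: "M.lincomb b A = (\<Sum>f\<in>A. Poly_Mapping.map ((*) (b f)) f)"
    if "A \<subseteq> monomial ` words m" for b A
    unfolding M.lincomb_def using that
    by (subst finsum_free_alg) (auto simp: monomial_def dest!: keys_map_times[THEN subsetD])
  show ?thesis
  proof safe
    fix f w assume "f \<in> ?span" and w: "w \<in> Poly_Mapping.keys f"
    then obtain b A where f: "f = M.lincomb b A" and A: "A \<subseteq> monomial ` W"
      by (auto simp: M.span_def)
    have "A \<subseteq> monomial ` words m" using A assms by blast
    then have "Poly_Mapping.lookup f w = (\<Sum>g\<in>A. b g * Poly_Mapping.lookup g w)"
      by (simp add: f lc lookup_sum lookup_map_times)
    then have "(\<Sum>g\<in>A. b g * Poly_Mapping.lookup g w) \<noteq> 0" using w by (simp add: in_keys_iff)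
    then obtain g where "g \<in> A" "Poly_Mapping.lookup g w \<noteq> 0"
      by (auto elim: sum.not_neutral_contains_not_neutral)
    then show "w \<in> W" using A by (auto simp: monomial_def lookup_single when_def split: if_splits)
  next
    fix f :: "nat list \<Rightarrow>\<^sub>0 'k" assume f: "Poly_Mapping.keys f \<subseteq> W"
    (* lincomb indexes its coefficients by vectors; the word is recovered from its monomial. *)
    define b where "b g = Poly_Mapping.lookup f (the_elem (Poly_Mapping.keys g))"
      for g :: "nat list \<Rightarrow>\<^sub>0 'k"
    let ?A = "monomial ` Poly_Mapping.keys f :: (nat list \<Rightarrow>\<^sub>0 'k) set"
    have inj: "inj_on (monomial :: _ \<Rightarrow> _ \<Rightarrow>\<^sub>0 'k) (Poly_Mapping.keys f)"
      by (simp add: inj_on_def)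
    have "M.lincomb b ?A = (\<Sum>g\<in>?A. Poly_Mapping.map ((*) (b g)) g)"
      using f assms by (intro lc) auto
    also have "\<dots> = (\<Sum>w\<in>Poly_Mapping.keys f. Poly_Mapping.single w (Poly_Mapping.lookup f w))"
      by (subst sum.reindex[OF inj]) (simp add: monomial_def b_def)
    finally have "f = M.lincomb b ?A" by (simp add: sum_single_keys)
    moreover have "finite ?A" "?A \<subseteq> monomial ` W" using f by auto
    ultimately show "f \<in> ?span" unfolding M.span_def mem_Collect_eq
      by (intro exI[of _ b] exI[of _ ?A]) simp
  qed
qed

lemma graded_component_eq:
  "graded_component m U n
    = coset m U ` {f :: nat list \<Rightarrow>\<^sub>0 'k::field. Poly_Mapping.keys f \<subseteq> {w \<in> words m. length w = n}}"
  unfolding graded_component_def by (subst span_monomials) auto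

text \<open>A linear image of a linear space is a linear space. The target \<open>V\<close> is only a record of
  operations, so the axioms have to be transported along \<open>T\<close>.\<close>

lemma vectorspace_image:
  fixes V :: "('k::field, 'v) module" and S :: "('a \<Rightarrow>\<^sub>0 'k) set"
  assumes S_zero: "0 \<in> S" and S_add: "\<And>f g. f \<in> S \<Longrightarrow> g \<in> S \<Longrightarrow> f + g \<in> S"
    and S_smult: "\<And>c f. f \<in> S \<Longrightarrow> Poly_Mapping.map ((*) c) f \<in> S"
    and S_uminus: "\<And>f. f \<in> S \<Longrightarrow> - f \<in> S"
    and carr: "carrier V = T ` S"
    and T_zero: "\<zero>\<^bsub>V\<^esub> = T 0"
    and T_add: "\<And>f g. f \<in> S \<Longrightarrow> g \<in> S \<Longrightarrow> T f \<oplus>\<^bsub>V\<^esub> T g = T (f + g)"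
    and T_smult: "\<And>c f. f \<in> S \<Longrightarrow> c \<odot>\<^bsub>V\<^esub> T f = T (Poly_Mapping.map ((*) c) f)"
  shows "vectorspace class_ring V"
proof (rule vs_criteria)
  show "field (class_ring :: 'k ring)" by (rule class_field)
  show "\<forall>v\<in>carrier V. \<exists>w\<in>carrier V. v \<oplus>\<^bsub>V\<^esub> w = \<zero>\<^bsub>V\<^esub>"
  proof
    fix v assume "v \<in> carrier V"
    then obtain f where "f \<in> S" "v = T f" by (auto simp: carr)
    then show "\<exists>w\<in>carrier V. v \<oplus>\<^bsub>V\<^esub> w = \<zero>\<^bsub>V\<^esub>"
      by (intro bexI[of _ "T (- f)"]) (simp_all add: carr T_add T_zero S_uminus)
  qed
  show "\<zero>\<^bsub>V\<^esub> \<in> carrier V" by (simp add: carr T_zero S_zero)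
  show "\<forall>v w. v \<in> carrier V \<and> w \<in> carrier V \<longrightarrow> v \<oplus>\<^bsub>V\<^esub> w \<in> carrier V"
    by (clarsimp simp: carr T_add S_add)
  show "\<forall>c v. c \<in> carrier class_ring \<and> v \<in> carrier V \<longrightarrow> c \<odot>\<^bsub>V\<^esub> v \<in> carrier V"
    by (clarsimp simp: carr T_smult S_smult)
  show "\<forall>v w. v \<in> carrier V \<and> w \<in> carrier V \<longrightarrow> v \<oplus>\<^bsub>V\<^esub> w = w \<oplus>\<^bsub>V\<^esub> v"
    by (clarsimp simp: carr T_add add.commute)
  show "\<forall>v w x. v \<in> carrier V \<and> w \<in> carrier V \<and> x \<in> carrier V \<longrightarrow>
      v \<oplus>\<^bsub>V\<^esub> w \<oplus>\<^bsub>V\<^esub> x = v \<oplus>\<^bsub>V\<^esub> (w \<oplus>\<^bsub>V\<^esub> x)"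
    by (clarsimp simp: carr T_add S_add add.assoc)
  show "\<forall>v\<in>carrier V. v \<oplus>\<^bsub>V\<^esub> \<zero>\<^bsub>V\<^esub> = v"
    by (clarsimp simp: carr T_zero T_add S_zero)
  show "\<forall>a b v. a \<in> carrier class_ring \<and> b \<in> carrier class_ring \<and> v \<in> carrier V \<longrightarrow>
      (a \<otimes>\<^bsub>class_ring\<^esub> b) \<odot>\<^bsub>V\<^esub> v = a \<odot>\<^bsub>V\<^esub> (b \<odot>\<^bsub>V\<^esub> v)"
    by (clarsimp simp: carr T_smult S_smult map_times_simps(3))
  show "\<forall>v\<in>carrier V. \<one>\<^bsub>class_ring\<^esub> \<odot>\<^bsub>V\<^esub> v = v"
    by (clarsimp simp: carr T_smult map_times_simps(4))
  show "\<forall>a b v. a \<in> carrier class_ring \<and> b \<in> carrier class_ring \<and> v \<in> carrier V \<longrightarrow>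
      (a \<oplus>\<^bsub>class_ring\<^esub> b) \<odot>\<^bsub>V\<^esub> v = a \<odot>\<^bsub>V\<^esub> v \<oplus>\<^bsub>V\<^esub> b \<odot>\<^bsub>V\<^esub> v"
    by (clarsimp simp: carr T_smult T_add S_smult map_times_simps(1))
  show "\<forall>a v w. a \<in> carrier class_ring \<and> v \<in> carrier V \<and> w \<in> carrier V \<longrightarrow>
      a \<odot>\<^bsub>V\<^esub> (v \<oplus>\<^bsub>V\<^esub> w) = a \<odot>\<^bsub>V\<^esub> v \<oplus>\<^bsub>V\<^esub> a \<odot>\<^bsub>V\<^esub> w"
    by (clarsimp simp: carr T_smult T_add S_add S_smult map_times_simps(2))
qed
lemma vectorspace_graded_component:
  assumes U: "U \<subseteq> words m"
  shows "vectorspace (class_ring :: 'k::field ring)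
    (monomial_alg m U \<lparr>carrier := graded_component m U n\<rparr>)"
proof -
  let ?S = "{f :: nat list \<Rightarrow>\<^sub>0 'k. Poly_Mapping.keys f \<subseteq> {w \<in> words m. length w = n}}"
  have S: "Poly_Mapping.keys f \<subseteq> words m" if "f \<in> ?S" for f using that by auto
  show ?thesis
  proof (rule vectorspace_image[where S = ?S and T = "coset m U"])
    show "f + g \<in> ?S" if "f \<in> ?S" "g \<in> ?S" for f g
      using that unfolding mem_Collect_eq by (rule keys_plus_subset)
    show "Poly_Mapping.map ((*) c) f \<in> ?S" if "f \<in> ?S" for c f
      using that keys_map_times[of c f] by blast
    show "- f \<in> ?S" if "f \<in> ?S" for f using that by (simp add: keys_uminus)
  qed (simp_all add: graded_component_eq coset_zero[OF U] coset_add[OF U S S] coset_smult[OF U S]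
      del: mem_Collect_eq, simp)
qed

lemma finsum_cosets:
  fixes f :: "'a \<Rightarrow> nat list \<Rightarrow>\<^sub>0 'k::field"
  assumes U: "U \<subseteq> words m" and "finite A"
    and "\<And>x. x \<in> A \<Longrightarrow> Poly_Mapping.keys (f x) \<subseteq> {w \<in> words m. length w = n}"
  shows "finsum (monomial_alg m U \<lparr>carrier := graded_component m U n\<rparr>) (\<lambda>x. coset m U (f x)) A
    = coset m U (sum f A)"
proof -
  let ?V = "monomial_alg m U \<lparr>carrier := graded_component m U n\<rparr> :: ('k, _) module"
  interpret vectorspace "class_ring :: 'k ring" ?V
    by (rule vectorspace_graded_component[OF U])
  show ?thesis
    using assms(2,3)
  proof (induction A rule: finite_induct)
    case empty
    show ?case by (simp add: coset_zero[OF U])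
  next
    case (insert x A)
    have "(\<lambda>x. coset m U (f x)) \<in> A \<rightarrow> carrier ?V" "coset m U (f x) \<in> carrier ?V"
      using insert.prems by (auto simp: graded_component_eq)
    then have "finsum ?V (\<lambda>x. coset m U (f x)) (insert x A)
        = coset m U (f x) \<oplus>\<^bsub>?V\<^esub> finsum ?V (\<lambda>x. coset m U (f x)) A"
      using insert.hyps by (intro M.finsum_insert)
    also have "\<dots> = coset m U (f x) \<oplus>\<^bsub>monomial_alg m U\<^esub> coset m U (sum f A)"
      using insert by simp
    also have "\<dots> = coset m U (f x + sum f A)"
    proof (rule coset_add[OF U])
      show "Poly_Mapping.keys (f x) \<subseteq> words m" using insert.prems by blast
      have "Poly_Mapping.keys (f y) \<subseteq> words m" if "y \<in> A" for y using insert.prems that by blast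
      with insert.hyps(1) show "Poly_Mapping.keys (sum f A) \<subseteq> words m"
        by (induction A rule: finite_induct) (simp_all add: keys_plus_subset)
    qed
    finally show ?case using insert.hyps by simp
  qed
qed

text \<open>The cosets of the normal words are a basis: a combination of normal words that lies in the ideal
  is supported on multiples and hence zero, and a polynomial differs from the part of it that is
  supported on normal words by an element of the ideal.\<close>

lemma dim_graded_component:
  assumes U: "U \<subseteq> words m"
  shows "vectorspace.dim (class_ring :: 'k::field ring)
    (monomial_alg m U \<lparr>carrier := graded_component m U n\<rparr>)
    = card {w \<in> normal_words m U. length w = n}"
proof -
  let ?V = "monomial_alg m U \<lparr>carrier := graded_component m U n\<rparr> :: ('k, _) module"
  interpret vectorspace "class_ring :: 'k ring" ?V
    by (rule vectorspace_graded_component[OF U])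
  define W where "W = {w \<in> normal_words m U. length w = n}"
  define T where "T w = coset m U (monomial w :: _ \<Rightarrow>\<^sub>0 'k)" for w
  have W_sub: "W \<subseteq> {w \<in> words m. length w = n}" by (auto simp: W_def normal_words_def)
  have W_words: "W \<subseteq> words m" using W_sub by auto
  have fin: "finite W" using finite_words_of_length W_sub by (rule finite_subset[rotated])
  have W_mult: "w \<notin> multiples m U" if "w \<in> W" for w
    using that by (auto simp: W_def normal_words_def multiples_def)
  have keys_sum: "Poly_Mapping.keys (\<Sum>w\<in>W. Poly_Mapping.single w (b w)) \<subseteq> W" for b :: "_ \<Rightarrow> 'k"
    using fin by (auto simp: in_keys_iff lookup_sum_single split: if_splits)
  have inj: "inj_on T W"
  proof (rule inj_onI)
    fix v w assume vw: "v \<in> W" "w \<in> W" "T v = T w"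
    then have "Poly_Mapping.keys (monomial v - monomial w :: _ \<Rightarrow>\<^sub>0 'k) \<subseteq> multiples m U"
      using W_words by (subst coset_eq_iff[OF U, symmetric]) (auto simp: T_def)
    then have "v \<notin> Poly_Mapping.keys (monomial v - monomial w :: _ \<Rightarrow>\<^sub>0 'k)"
      using W_mult vw by blast
    then show "v = w"
      by (auto simp: in_keys_iff lookup_minus monomial_def lookup_single when_def split: if_splits)
  qed
  have T_carrier: "T ` W \<subseteq> carrier ?V"
    using W_sub by (auto simp: T_def graded_component_eq)
  have lincomb: "lincomb a (T ` W) = coset m U (\<Sum>w\<in>W. Poly_Mapping.single w (a (T w)))" for a
  proof -
    have T_smult: "a v \<odot>\<^bsub>?V\<^esub> v \<in> carrier ?V" if "v \<in> T ` W" for v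
      using that T_carrier by (intro smult_closed) auto
    have "lincomb a (T ` W) = finsum ?V (\<lambda>w. a (T w) \<odot>\<^bsub>?V\<^esub> T w) W"
      unfolding lincomb_def using T_smult inj by (intro M.finsum_reindex) auto
    also have "\<dots> = finsum ?V (\<lambda>w. coset m U (Poly_Mapping.single w (a (T w)))) W"
    proof (rule M.finsum_cong')
      show "a (T w) \<odot>\<^bsub>?V\<^esub> T w = coset m U (Poly_Mapping.single w (a (T w)))" if "w \<in> W" for w
        using that W_words by (simp add: T_def coset_smult[OF U] subset_iff) (simp add: monomial_def)
    qed (use W_sub in \<open>auto simp: graded_component_eq\<close>)
    also have "\<dots> = coset m U (\<Sum>w\<in>W. Poly_Mapping.single w (a (T w)))"
      using W_sub by (intro finsum_cosets[OF U fin]) auto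
    finally show ?thesis .
  qed
  have "lin_indpt (T ` W)"
  proof (rule finite_lin_indpt2)
    fix a assume "lincomb a (T ` W) = \<zero>\<^bsub>?V\<^esub>"
    then have "coset m U (\<Sum>w\<in>W. Poly_Mapping.single w (a (T w))) = coset m U 0"
      by (simp add: lincomb coset_zero[OF U])
    then have "Poly_Mapping.keys (\<Sum>w\<in>W. Poly_Mapping.single w (a (T w))) \<subseteq> multiples m U"
      using subset_trans[OF keys_sum W_words] by (subst (asm) coset_eq_iff[OF U]) simp_all
    then have "a (T w) = 0" if "w \<in> W" for w
      using W_mult[OF that] that fin by (auto simp: subset_iff in_keys_iff lookup_sum_single split: if_splits)
    then show "\<forall>v\<in>T ` W. a v = \<zero>\<^bsub>class_ring\<^esub>" by simp
  qed (use fin T_carrier in auto)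
  moreover have "gen_set (T ` W)"
  proof
    show "span (T ` W) \<subseteq> carrier ?V"
      using T_carrier by (rule span_is_subset2)
    show "carrier ?V \<subseteq> span (T ` W)"
    proof
      fix v assume "v \<in> carrier ?V"
      then obtain f :: "nat list \<Rightarrow>\<^sub>0 'k" where v: "v = coset m U f"
        and f: "Poly_Mapping.keys f \<subseteq> {w \<in> words m. length w = n}"
        by (auto simp: graded_component_eq)
      (* Vectors are cosets, so the coefficient of a coset is read off at its unique normal word. *)
      define a where "a = (\<lambda>v. Poly_Mapping.lookup f (inv_into W T v))"
      let ?g = "\<Sum>w\<in>W. Poly_Mapping.single w (Poly_Mapping.lookup f w)"
      have "lincomb a (T ` W) = coset m U ?g"
        using inj by (simp add: lincomb a_def)
      also have "\<dots> = coset m U f"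
      proof (subst coset_eq_iff[OF U])
        show "Poly_Mapping.keys ?g \<subseteq> words m" using keys_sum W_words by (rule subset_trans)
        show "Poly_Mapping.keys f \<subseteq> words m" using f by blast
        show "Poly_Mapping.keys (?g - f) \<subseteq> multiples m U"
        proof
          fix w assume "w \<in> Poly_Mapping.keys (?g - f)"
          then have "w \<in> Poly_Mapping.keys f" "w \<notin> W"
            using fin by (auto simp: in_keys_iff lookup_minus lookup_sum_single split: if_splits)
          then show "w \<in> multiples m U"
            using f by (auto simp: W_def multiples_def normal_words_def)
        qed
      qed
      finally show "v \<in> span (T ` W)"
        using fin T_carrier by (auto simp: finite_span v)
    qed
  qed
  ultimately have "basis (T ` W)" using T_carrier by (simp add: basis_def)
  then have "dim = card (T ` W)" using fin by (intro dim_basis) auto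
  also have "\<dots> = card W" using inj by (rule card_image)
  finally show ?thesis by (simp add: W_def)
qed

lemma hilbert_series_eq:
  assumes "U \<subseteq> words m"
  shows "hilbert_series K m U = Abs_fps (\<lambda>n. of_nat (card {w \<in> normal_words m U. length w = n}))"
  using assms by (simp add: hilbert_series_def dim_graded_component)

section \<open>Counting the words of a language\<close>

text \<open>The series has rational coefficients because the Hilbert series does.\<close>

definition census :: "'a list set \<Rightarrow> rat fps" where
  "census L = Abs_fps (\<lambda>n. of_nat (card {w \<in> L. length w = n}))"

definition glue :: "'a \<Rightarrow> 'a list set \<Rightarrow> 'a list set \<Rightarrow> 'a list set" where
  "glue y L M = {u @ y # v | u v. u \<in> L \<and> v \<in> M}"

lemma finite_slice: "L \<subseteq> words m \<Longrightarrow> finite {w \<in> L. length w = n}"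
  by (rule finite_subset[OF _ finite_words_of_length[of m n]]) auto

lemma census_Un:
  assumes "L \<subseteq> words m" "M \<subseteq> words m" "L \<inter> M = {}"
  shows "census (L \<union> M) = census L + census M"
proof (rule fps_ext)
  fix n
  have "{w \<in> L \<union> M. length w = n} = {w \<in> L. length w = n} \<union> {w \<in> M. length w = n}" by auto
  moreover have "{w \<in> L. length w = n} \<inter> {w \<in> M. length w = n} = {}" using assms(3) by auto
  ultimately show "census (L \<union> M) $ n = (census L + census M) $ n"
    using assms by (simp add: census_def card_Un_disjoint finite_slice)
qed

lemma first_marker_unique:
  assumes "y \<notin> set u" "y \<notin> set u'" "u @ y # v = u' @ y # v'"
  shows "u = u' \<and> v = v'"
proof -
  have "takeWhile (\<lambda>x. x \<noteq> y) (u @ y # v) = u" "takeWhile (\<lambda>x. x \<noteq> y) (u' @ y # v') = u'"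
    using assms(1,2) by (auto simp: takeWhile_append takeWhile_eq_all_conv[THEN iffD2])
  with assms(3) show ?thesis by auto
qed

text \<open>No word of \<open>L\<close> contains \<open>y\<close>, so a word of \<open>glue y L M\<close> determines its two parts by its first \<open>y\<close>.
  The lengths of the parts add up to one less than the length of the word, which gives the Cauchy
  product of the two series, shifted by one.\<close>

lemma census_glue:
  assumes L: "L \<subseteq> words m" and M: "M \<subseteq> words m" and y: "\<And>u. u \<in> L \<Longrightarrow> y \<notin> set u"
  shows "census (glue y L M) = census L * fps_X * census M"
proof (rule fps_ext)
  fix n
  show "census (glue y L M) $ n = (census L * fps_X * census M) $ n"
  proof (cases n)
    case 0
    have "{w \<in> glue y L M. length w = 0} = {}" by (auto simp: glue_def)
    with 0 show ?thesis by (simp add: census_def fps_mult_fps_X_commute mult.assoc)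
  next
    case (Suc k)
    define S where "S = (SIGMA i:{0..k}. {u \<in> L. length u = i} \<times> {v \<in> M. length v = k - i})"
    have "{w \<in> glue y L M. length w = Suc k} = (\<lambda>(i, u, v). u @ y # v) ` S"
    proof (intro equalityI subsetI)
      fix w assume "w \<in> {w \<in> glue y L M. length w = Suc k}"
      then obtain u v where uv: "u \<in> L" "v \<in> M" "w = u @ y # v" "length u + length v = k"
        by (auto simp: glue_def)
      then show "w \<in> (\<lambda>(i, u, v). u @ y # v) ` S"
        by (intro rev_image_eqI[of "(length u, u, v)"]) (auto simp: S_def)
    qed (auto simp: glue_def S_def)
    moreover have "inj_on (\<lambda>(i, u, v). u @ y # v) S"
    proof (rule inj_onI)
      fix s s' assume S: "s \<in> S" "s' \<in> S"
        and eq: "(\<lambda>(i, u, v). u @ y # v) s = (\<lambda>(i, u, v). u @ y # v) s'"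
      obtain i u v where s: "s = (i, u, v)" by (cases s)
      obtain i' u' v' where s': "s' = (i', u', v')" by (cases s')
      have "u = u' \<and> v = v'"
        using S eq by (intro first_marker_unique[of y]) (auto simp: S_def y s s')
      with S show "s = s'" by (auto simp: S_def s s')
    qed
    ultimately have "card {w \<in> glue y L M. length w = Suc k} = card S"
      by (simp add: card_image)
    also have "\<dots> = (\<Sum>i=0..k. card {u \<in> L. length u = i} * card {v \<in> M. length v = k - i})"
      unfolding S_def using finite_slice[OF L] finite_slice[OF M]
      by (subst card_SigmaI) (auto simp: card_cartesian_product)
    finally have "census (glue y L M) $ Suc k = (census L * census M) $ k"
      by (simp add: census_def fps_mult_nth)
    also have "\<dots> = (fps_X * (census L * census M)) $ Suc k" by simp
    also have "fps_X * (census L * census M) = census L * fps_X * census M"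
      by (simp only: mult_ac)
    finally show ?thesis using Suc by simp
  qed
qed

lemma census_words: "census (words d) = inverse (1 - of_nat d * fps_X)"
proof -
  have nth: "census (words d) $ n = of_nat d ^ n" for n
    by (simp add: census_def card_words_of_length)
  have "(1 - of_nat d * fps_X) * census (words d) = 1"
  proof (rule fps_ext)
    fix n
    have "(1 - of_nat d * fps_X) * census (words d)
        = census (words d) - fps_X * (fps_const (of_nat d) * census (words d))"
      by (simp add: fps_of_nat algebra_simps)
    then show "((1 - of_nat d * fps_X) * census (words d)) $ n = 1 $ n"
      by (cases n) (simp_all add: nth)
  qed
  then show ?thesis by (rule fps_inverse_unique[symmetric])
qed

section \<open>Factor-closed languages\<close>

text \<open>Every factor arises by deleting letters one at a time from the two ends.\<close>

lemma sublist_mem_closed: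
  assumes tl: "\<And>x w. x # w \<in> G \<Longrightarrow> w \<in> G" and butlast: "\<And>x w. w @ [x] \<in> G \<Longrightarrow> w \<in> G"
    and "w \<in> G" "sublist u w"
  shows "u \<in> G"
proof -
  obtain v z where w: "w = v @ u @ z" using assms(4) by (auto simp: sublist_def)
  have drop_prefix: "v @ w \<in> G \<Longrightarrow> w \<in> G" for v w by (induction v) (auto dest: tl)
  have drop_suffix: "w @ z \<in> G \<Longrightarrow> w \<in> G" for w z
  proof (induction z rule: rev_induct)
    case (snoc x z)
    then show ?case using butlast[of "w @ z" x] by simp
  qed simp
  show ?thesis using assms(3) drop_prefix drop_suffix w by blast
qed

text \<open>A word of a factor-closed language has no factor in the complement, whereas a word outside of it
  is a factor of itself.\<close>

lemma normal_words_complement: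
  assumes "G \<subseteq> words m" "\<And>u w. w \<in> G \<Longrightarrow> sublist u w \<Longrightarrow> u \<in> G"
  shows "normal_words m (words m - G) = G"
  using assms by (auto simp: normal_words_def)

section \<open>Words with at most two markers\<close>

text \<open>The middle word from \<open>W\<close> is enclosed by two markers, so deleting a letter at an end never shortens
  it: either an outer part gets shorter, or a marker is deleted. In the latter case the other marker
  remains, and words of \<open>X\<close> with one marker between them are all in the language. The part from \<open>P\<close>
  is shortened only at its front and the part from \<open>Q\<close> only at its back.\<close>

lemma marked_language_factor_closed:
  assumes X_tl: "\<And>x w. x # w \<in> X \<Longrightarrow> w \<in> X" and X_butlast: "\<And>x w. w @ [x] \<in> X \<Longrightarrow> w \<in> X"
    and P: "P \<subseteq> X" "\<And>x w. x # w \<in> P \<Longrightarrow> w \<in> P"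
    and Q: "Q \<subseteq> X" "\<And>x w. w @ [x] \<in> Q \<Longrightarrow> w \<in> Q"
    and W: "W \<subseteq> X"
    and "w \<in> X \<union> glue y X X \<union> glue y P (glue y W Q)" "sublist u w"
  shows "u \<in> X \<union> glue y X X \<union> glue y P (glue y W Q)"
proof -
  define G1 where "G1 = glue y X X"
  define G2 where "G2 = glue y P (glue y W Q)"
  define G where "G = X \<union> G1 \<union> G2"
  have "w \<in> G" using assms(8) by (simp add: G_def G1_def G2_def)
  have "u \<in> G"
  proof (rule sublist_mem_closed[OF _ _ \<open>w \<in> G\<close> \<open>sublist u w\<close>])
    fix x w assume "x # w \<in> G"
    then consider "x # w \<in> X" | "x # w \<in> G1" | "x # w \<in> G2" by (auto simp: G_def)
    then show "w \<in> G"
    proof cases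
      case 1 then show ?thesis by (auto simp: G_def dest: X_tl)
    next
      case 2
      then obtain u v where "x # w = u @ y # v" "u \<in> X" "v \<in> X" by (auto simp: G1_def glue_def)
      then show ?thesis
        by (cases u) (auto simp: G_def G1_def glue_def dest: X_tl)
    next
      case 3
      then obtain u v z where uvz: "x # w = u @ y # v @ y # z" "u \<in> P" "v \<in> W" "z \<in> Q"
        by (auto simp: G2_def glue_def)
      show ?thesis
      proof (cases u)
        case Nil
        then have "w \<in> G1" using uvz W Q(1) by (auto simp: G1_def glue_def)
        then show ?thesis by (simp add: G_def)
      next
        case (Cons x' u')
        then have "u' \<in> P" "w = u' @ y # v @ y # z" using uvz P(2) by auto
        then have "w \<in> G2" using uvz by (auto simp: G2_def glue_def)
        then show ?thesis by (simp add: G_def)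
      qed
    qed
  next
    fix x w assume "w @ [x] \<in> G"
    then consider "w @ [x] \<in> X" | "w @ [x] \<in> G1" | "w @ [x] \<in> G2" by (auto simp: G_def)
    then show "w \<in> G"
    proof cases
      case 1 then show ?thesis by (auto simp: G_def dest: X_butlast)
    next
      case 2
      then obtain u v where "w @ [x] = u @ y # v" "u \<in> X" "v \<in> X" by (auto simp: G1_def glue_def)
      then show ?thesis
        by (cases v rule: rev_cases) (auto simp: G_def G1_def glue_def dest: X_butlast)
    next
      case 3
      then obtain u v z where uvz: "w @ [x] = u @ y # v @ y # z" "u \<in> P" "v \<in> W" "z \<in> Q"
        by (auto simp: G2_def glue_def)
      show ?thesis
      proof (cases z rule: rev_cases)
        case Nil
        then have "w = u @ y # v" using uvz(1) by (metis append_Cons append_assoc butlast_snoc)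
        then have "w \<in> G1" using uvz W P(1) by (auto simp: G1_def glue_def)
        then show ?thesis by (simp add: G_def)
      next
        case (snoc z' x')
        then have "z' \<in> Q" "w = u @ y # v @ y # z'" using uvz Q(2) by auto
        then have "w \<in> G2" using uvz by (auto simp: G2_def glue_def)
        then show ?thesis by (simp add: G_def)
      qed
    qed
  qed
  then show ?thesis by (simp add: G_def G1_def G2_def)
qed

text \<open>The three parts are disjoint because their words contain the marker exactly 0, 1 and 2 times.\<close>

lemma census_marked_language:
  assumes X_sub: "X \<subseteq> words m" and y: "y \<in> {1..m}" and y_notin: "\<And>u. u \<in> X \<Longrightarrow> y \<notin> set u"
    and P: "P \<subseteq> X" and W: "W \<subseteq> X" and Q: "Q \<subseteq> X"
  shows "X \<union> glue y X X \<union> glue y P (glue y W Q) \<subseteq> words m"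
    and "census (X \<union> glue y X X \<union> glue y P (glue y W Q))
      = census X + census X * fps_X * census X + census P * fps_X * (census W * fps_X * census Q)"
proof -
  have glue_sub: "glue y L M \<subseteq> words m" if "L \<subseteq> words m" "M \<subseteq> words m" for L M
    using that y by (auto simp: glue_def)
  have sub: "P \<subseteq> words m" "W \<subseteq> words m" "Q \<subseteq> words m"
    using X_sub P W Q by auto
  define G1 where "G1 = glue y X X"
  define G2 where "G2 = glue y P (glue y W Q)"
  have G_sub: "G1 \<subseteq> words m" "G2 \<subseteq> words m"
    unfolding G1_def G2_def by (simp_all add: glue_sub X_sub sub)
  then show "X \<union> glue y X X \<union> glue y P (glue y W Q) \<subseteq> words m"
    using X_sub by (simp add: G1_def G2_def)
  have c0: "count_list w y = 0" if "w \<in> X" for w using that y_notin by (simp add: count_list_0_iff)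
  have c1: "count_list w y = 1" if "w \<in> G1" for w
    using that by (auto simp: G1_def glue_def c0)
  have c2: "count_list w y = 2" if "w \<in> G2" for w
    using that P Q W by (auto simp: G2_def glue_def c0 subset_iff)
  have "X \<inter> G1 = {}" "(X \<union> G1) \<inter> G2 = {}"
    using c0 c1 c2 by fastforce+
  then have "census (X \<union> G1 \<union> G2) = census X + census G1 + census G2"
    using X_sub G_sub by (simp add: census_Un[of _ m])
  moreover have "census G1 = census X * fps_X * census X"
    unfolding G1_def by (rule census_glue[OF X_sub X_sub y_notin])
  moreover have "census G2 = census P * fps_X * (census W * fps_X * census Q)"
  proof -
    have "census (glue y W Q) = census W * fps_X * census Q"
      using sub W y_notin by (intro census_glue) auto
    then show ?thesis
      unfolding G2_def using P sub y_notin by (subst census_glue[OF _ glue_sub]) auto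
  qed
  ultimately show "census (X \<union> glue y X X \<union> glue y P (glue y W Q))
      = census X + census X * fps_X * census X + census P * fps_X * (census W * fps_X * census Q)"
    by (simp add: G1_def G2_def)
qed

theorem theorem1:
  fixes a :: "nat \<Rightarrow> nat" and d p :: nat
  assumes "d > 0" and "\<And>n. a n \<le> d ^ n" and "p \<in> {0, 1, 2}"
  shows "\<exists>U \<subseteq> words (d + 1).
    hilbert_series TYPE('k::field) (d + 1) U =
      1 / (1 - of_nat d * fps_X)
      + fps_X / (1 - of_nat d * fps_X) ^ 2
      + fps_X ^ 2 * Abs_fps (\<lambda>n. of_nat (a n)) / (1 - of_nat d * fps_X) ^ p"
proof -
  let ?y = "d + 1" and ?X = "words d" and ?c = "1 - of_nat d * fps_X :: rat fps"
  have "\<exists>V \<subseteq> {w \<in> ?X. length w = n}. card V = a n" for n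
    using assms(2) by (metis card_words_of_length obtain_subset_with_card_n)
  then obtain V where V: "\<And>n. V n \<subseteq> {w \<in> ?X. length w = n}" "\<And>n. card (V n) = a n"
    by metis
  define W where "W = (\<Union>n. V n)"
  have W: "W \<subseteq> ?X" using V(1) by (auto simp: W_def)
  have "{w \<in> W. length w = n} = V n" for n using V(1) by (auto simp: W_def)
  then have census_W: "census W = Abs_fps (\<lambda>n. of_nat (a n))" by (simp add: census_def V(2))

  (* For p = 1 only the last part varies; the choice between the two ends is arbitrary. *)
  define P Q where "P = (if p = 2 then ?X else {[]})" and "Q = (if p = 0 then {[]} else ?X)"
  define G where "G = ?X \<union> glue ?y ?X ?X \<union> glue ?y P (glue ?y W Q)"
  have Nil: "[] \<in> ?X" by (simp add: words_def)
  have X_tl: "\<And>x w. x # w \<in> ?X \<Longrightarrow> w \<in> ?X" and X_butlast: "\<And>x w. w @ [x] \<in> ?X \<Longrightarrow> w \<in> ?X"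
    by simp_all
  have P: "P \<subseteq> ?X" "\<And>x w. x # w \<in> P \<Longrightarrow> w \<in> P"
    and Q: "Q \<subseteq> ?X" "\<And>x w. w @ [x] \<in> Q \<Longrightarrow> w \<in> Q"
    using Nil by (auto simp: P_def Q_def split: if_splits)
  have X_sub: "?X \<subseteq> words (d + 1)" and y_notin: "\<And>u. u \<in> ?X \<Longrightarrow> ?y \<notin> set u"
    by (auto simp: words_def)
  note census_G = census_marked_language[OF X_sub _ y_notin P(1) W Q(1), folded G_def]
  have G_sub: "G \<subseteq> words (d + 1)" by (rule census_G) simp
  have "u \<in> G" if "w \<in> G" "sublist u w" for u w
    unfolding G_def
  proof (rule marked_language_factor_closed)
    show "w \<in> ?X \<union> glue ?y ?X ?X \<union> glue ?y P (glue ?y W Q)" using that(1) by (simp only: G_def)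
    show "sublist u w" by (rule that(2))
  qed (erule X_tl X_butlast P(2) Q(2) | rule P(1) Q(1) W)+
  then have normal: "normal_words (d + 1) (words (d + 1) - G) = G"
    by (rule normal_words_complement[OF G_sub])

  have "census P * census Q = census ?X ^ p"
  proof -
    have "census {[] :: nat list} = 1"
      by (rule fps_ext) (auto simp: census_def)
    then show ?thesis using assms(3) by (auto simp: P_def Q_def power2_eq_square)
  qed
  then have "census G
      = inverse ?c + fps_X * inverse ?c ^ 2 + fps_X ^ 2 * census W * inverse ?c ^ p"
    by (subst census_G) (simp_all add: census_words power2_eq_square mult_ac)
  also have "\<dots> = 1 / ?c + fps_X / ?c ^ 2 + fps_X ^ 2 * Abs_fps (\<lambda>n. of_nat (a n)) / ?c ^ p"
    by (simp add: fps_divide_unit fps_inverse_power census_W fps_power_zeroth)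
  finally have "hilbert_series TYPE('k) (d + 1) (words (d + 1) - G) = \<dots>"
    by (simp only: hilbert_series_eq[OF Diff_subset] normal census_def)
  then show ?thesis by (intro exI[of _ "words (d + 1) - G"] conjI Diff_subset)
qed

end
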